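(* Let $G$ and $H$ be finite, simple, connected graphs with $n(H)=|V(H)|\ge 2$, let $u\in V(G)$, and suppose that $G(u)$ is not a rooted path (that is, it is not the case that $G$ is a path and $u$ is an end vertex of it). Let $X=G(u)\sqcap H$ be the hierarchical product of $G$ and $H$ with respect to $\{u\}$. Then $$\mathrm{edim}(X)=n(H)\cdot \mathrm{edim}(G(u)),$$ where $\mathrm{edim}(X)$ is the edge metric dimension of $X$ and $\mathrm{edim}(G(u))$ is the invariant of the pair $(G,u)$ defined in the context.
   Context: All graphs are finite, simple and connected; $d_G(u,v)$ is the shortest-path distance, and $n(H)=|V(H)|$. Distance from a vertex to an edge: for $u\in V(G)$ and $xy\in E(G)$, $d_G(u,xy)=\min\{d_G(u,x),d_G(u,y)\}$. Edge metric generators: for $F\subseteq E(G)$, a set $S\subseteq V(G)$ is an edge metric generator for $F$ if for any two distinct $e,f\in F$ there is $s\in S$ with $d_G(s,e)\neq d_G(s,f)$. The edge metric dimension $\mathrm{edim}(G)$ is the minimum cardinality of an edge metric generator for $E(G)$. Hierarchical product: for graphs $G,H$ and $u\in V(G)$, $G(u)\sqcap H$ (short for $G(\{u\})\sqcap H$) has vertex set $V(G)\times V(H)$ and edge set $$\{(g,h)(g',h'): gg'\in E(G),\ h=h'\}\cup\{(u,h)(u,h'): hh'\in E(H)\}.$$ Rooted path: $G(u)$ is a rooted path if $G$ is a path and $u$ is an end vertex of $G$; the one-vertex graph $G=K_1$ with $u$ its only vertex counts as a rooted path. Equidistant discriminators: for $k\ge 0$ let $E_G(u,k)=\{e\in E(G):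 d_G(u,e)=k\}$. If $F\subseteq E(G)$ and $|F|\ge 2$, a set $Y\subseteq V(G)$ is an equidistant discriminator for $F$ if $Y$ is an edge metric generator for $F$; if $|F|\le 1$, the only equidistant discriminator for $F$ is $\emptyset$. The invariant $\mathrm{edim}(G(u))$ (short for $\mathrm{edim}(G(\{u\}))$; not to be confused with $\mathrm{edim}(G)$): $$\mathrm{edim}(G(u))=\min\left|\bigcup_{k\ge 0}S_G(u,k)\right|,$$ where the minimum is over all choices of equidistant discriminators $S_G(u,k)$ for $E_G(u,k)$, $k\ge 0$. That is, $\mathrm{edim}(G(u))$ is the cardinality of a smallest set $S\subseteq V(G)$ such that any two distinct edges $e,f$ of $G$ with $d_G(u,e)=d_G(u,f)$ satisfy $d_G(s,e)\neq d_G(s,f)$ for some $s\in S$. *)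

theory Defs
  imports Main
begin

record 'a sgraph =
  verts :: "'a set"
  edges :: "'a set set"

definition simple_graph :: "'a sgraph \<Rightarrow> bool" where
  "simple_graph G \<longleftrightarrow> finite (verts G) \<and>
     (\<forall>e\<in>edges G. \<exists>x y. x \<in> verts G \<and> y \<in> verts G \<and> x \<noteq> y \<and> e = {x, y})"

text \<open>A path is represented by the nonempty list of its vertices; its length is the number of its
  edges, that is, one less than the length of the list.\<close>

definition path_between :: "'a sgraph \<Rightarrow> 'a \<Rightarrow> 'a list \<Rightarrow> 'a \<Rightarrow> bool" where
  "path_between G x p y \<longleftrightarrow> p \<noteq> [] \<and> hd p = x \<and> last p = y \<and> distinct p \<and> set p \<subseteq> verts G \<and>
     (\<forall>i. Suc i < length p \<longrightarrow> {p ! i, p ! Suc i} \<in> edges G)"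

definition connected_graph :: "'a sgraph \<Rightarrow> bool" where
  "connected_graph G \<longleftrightarrow> verts G \<noteq> {} \<and>
     (\<forall>x\<in>verts G. \<forall>y\<in>verts G. \<exists>p. path_between G x p y)"

definition vdist :: "'a sgraph \<Rightarrow> 'a \<Rightarrow> 'a \<Rightarrow> nat" where
  "vdist G x y = (LEAST n. \<exists>p. path_between G x p y \<and> length p = Suc n)"

definition edist :: "'a sgraph \<Rightarrow> 'a \<Rightarrow> 'a set \<Rightarrow> nat" where
  "edist G s e = Min (vdist G s ` e)"

definition edge_metric_generator :: "'a sgraph \<Rightarrow> 'a set set \<Rightarrow> 'a set \<Rightarrow> bool" where
  "edge_metric_generator G F S \<longleftrightarrow> S \<subseteq> verts G \<and>
     (\<forall>e\<in>F. \<forall>f\<in>F. e \<noteq> f \<longrightarrow> (\<exists>s\<in>S. edist G s e \<noteq> edist G s f))"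

definition edim :: "'a sgraph \<Rightarrow> nat" where
  "edim G = (LEAST n. \<exists>S. edge_metric_generator G (edges G) S \<and> card S = n)"

definition hier_prod :: "'a sgraph \<Rightarrow> 'a \<Rightarrow> 'b sgraph \<Rightarrow> ('a \<times> 'b) sgraph" where
  "hier_prod G u H = \<lparr>
     verts = verts G \<times> verts H,
     edges = {{(g, h), (g', h)} | g g' h. {g, g'} \<in> edges G \<and> h \<in> verts H}
           \<union> {{(u, h), (u, h')} | h h'. {h, h'} \<in> edges H} \<rparr>"

text \<open>\<open>vs\<close> lists the vertices of the path graph \<open>G\<close> in order; a one-element list gives the
  one-vertex graph.\<close>

definition path_graph_order :: "'a sgraph \<Rightarrow> 'a list \<Rightarrow> bool" where
  "path_graph_order G vs \<longleftrightarrow> vs \<noteq> [] \<and> distinct vs \<and> verts G = set vs \<and>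
     edges G = {{vs ! i, vs ! Suc i} | i. Suc i < length vs}"

definition rooted_path :: "'a sgraph \<Rightarrow> 'a \<Rightarrow> bool" where
  "rooted_path G u \<longleftrightarrow> (\<exists>vs. path_graph_order G vs \<and> (u = hd vs \<or> u = last vs))"

definition edges_at :: "'a sgraph \<Rightarrow> 'a \<Rightarrow> nat \<Rightarrow> 'a set set" where
  "edges_at G u k = {e \<in> edges G. edist G u e = k}"

definition equidistant_discriminator :: "'a sgraph \<Rightarrow> 'a set set \<Rightarrow> 'a set \<Rightarrow> bool" where
  "equidistant_discriminator G F Y \<longleftrightarrow>
     (if card F \<ge> 2 then edge_metric_generator G F Y else Y = {})"

definition rooted_edim :: "'a sgraph \<Rightarrow> 'a \<Rightarrow> nat" where
  "rooted_edim G u = (LEAST n. \<exists>S :: nat \<Rightarrow> 'a set.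
     (\<forall>k. equidistant_discriminator G (edges_at G u k) (S k)) \<and> card (\<Union>k. S k) = n)"

end

theory Submission
  imports Defs
begin

text \<open>In the product \<open>X\<close> every copy of \<open>G\<close> is attached to the rest of \<open>X\<close> through its root only.
  Hence a vertex outside the copy at \<open>h\<close> sees an edge \<open>e\<close> of this copy at a distance that depends
  on \<open>e\<close> only through \<open>d(u, e)\<close>, while a vertex inside the copy sees it as in \<open>G\<close>
  (\<open>edist_copy_edge\<close>).

  Lower bound: two edges of one copy that are equidistant from the root can be told apart only from
  within that copy. So the trace of a generator of \<open>X\<close> on each copy resolves all pairs of edges
  equidistant from \<open>u\<close>, and therefore has at least \<open>edim (G(u))\<close> elements
  (\<open>generator_trace\<close>).

  Upper bound: put a smallest set \<open>S\<close> that resolves the pairs of edges equidistant from \<open>u\<close> into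
  every copy. Pairs in one copy at different distances from the root are resolved from any other
  copy, of which there is one because \<open>n(H) \<ge> 2\<close>. Any other pair of edges is resolved by a vertex of
  \<open>S\<close> in a copy whose root is close to one of the two edges (\<open>generator_product\<close>). Such vertices
  exist only if \<open>S\<close> is not empty, and this is where rooted paths are excluded: if no two edges
  were equidistant from \<open>u\<close>, every level of the breadth-first layering from \<open>u\<close> would be a single
  vertex, and \<open>G\<close> would be a path starting at \<open>u\<close> (\<open>equidistant_edges_exist\<close>).\<close>

section \<open>Distances in connected graphs\<close>

text \<open>Walks are easier to extend and to measure than paths without repeated vertices; the least
  length is the same for both.\<close>

inductive walk :: "'a sgraph \<Rightarrow> 'a \<Rightarrow> nat \<Rightarrow> 'a \<Rightarrow> bool" for G x where
  walk_refl: "x \<in> verts G \<Longrightarrow> walk G x 0 x"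
| walk_step: "walk G x n y \<Longrightarrow> {y, z} \<in> edges G \<Longrightarrow> walk G x (Suc n) z"

lemma simple_graph_edgeD:
  assumes "simple_graph G" "{x, y} \<in> edges G"
  shows "x \<in> verts G" "y \<in> verts G" "x \<noteq> y"
  using assms unfolding simple_graph_def by (fastforce simp: doubleton_eq_iff)+

lemma walk_of_path:
  assumes "path_between G x p y"
  shows "walk G x (length p - 1) y"
proof -
  have "walk G x i (p ! i)" if "i < length p" for i
    using that
  proof (induction i)
    case 0
    have "p ! 0 = x" "x \<in> verts G"
      using assms by (auto simp: path_between_def hd_conv_nth)
    then show ?case by (simp add: walk_refl)
  next
    case (Suc i)
    then show ?case
      using assms walk_step[of G x i "p ! i" "p ! Suc i"] by (auto simp: path_between_def)
  qed
  from this[of "length p - 1"] show ?thesis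
    using assms by (auto simp: path_between_def last_conv_nth)
qed

lemma path_between_take:
  assumes "path_between G x p y" "i < length p"
  shows "path_between G x (take (Suc i) p) (p ! i)"
  using assms by (auto simp: path_between_def last_conv_nth hd_take dest: in_set_takeD)

lemma path_between_snoc:
  assumes "path_between G x p y" "{y, z} \<in> edges G" "z \<in> verts G" "z \<notin> set p"
  shows "path_between G x (p @ [z]) z"
proof -
  have "p ! i = y" if "Suc i = length p" for i
    using assms that[symmetric] by (auto simp: path_between_def last_conv_nth)
  then have "{(p @ [z]) ! i, (p @ [z]) ! Suc i} \<in> edges G" if "Suc i < length (p @ [z])" for i
    using assms that by (cases "Suc i = length p") (auto simp: path_between_def nth_append)
  then show ?thesis
    using assms by (auto simp: path_between_def)
qed

lemma path_of_walk:
  assumes "simple_graph G" "walk G x n y"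
  shows "\<exists>p. path_between G x p y \<and> length p \<le> Suc n"
  using assms(2)
proof (induction rule: walk.induct)
  case walk_refl
  then show ?case
    by (intro exI[of _ "[x]"]) (auto simp: path_between_def)
next
  case (walk_step n y z)
  then obtain p where p: "path_between G x p y" "length p \<le> Suc n" by blast
  show ?case
  proof (cases "z \<in> set p")
    case True
    then obtain i where "i < length p" "p ! i = z" by (auto simp: in_set_conv_nth)
    then show ?thesis
      using path_between_take[OF p(1), of i] p(2) by (intro exI[of _ "take (Suc i) p"]) auto
  next
    case False
    then show ?thesis
      using path_between_snoc[OF p(1) walk_step(2)] simple_graph_edgeD[OF assms(1) walk_step(2)] p(2)
      by (intro exI[of _ "p @ [z]"]) auto
  qed
qed

lemma vdist_eq_walk:
  assumes "simple_graph G" "walk G x n y" "\<And>m. walk G x m y \<Longrightarrow> n \<le> m"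
  shows "vdist G x y = n"
  unfolding vdist_def
proof (rule Least_equality)
  obtain p where p: "path_between G x p y" "length p \<le> Suc n"
    using path_of_walk[OF assms(1,2)] by blast
  have "n \<le> length p - 1"
    using assms(3)[OF walk_of_path[OF p(1)]] .
  moreover have "p \<noteq> []" using p by (auto simp: path_between_def)
  ultimately have "length p = Suc n" using p(2) by (cases p) auto
  then show "\<exists>p. path_between G x p y \<and> length p = Suc n" using p by blast
next
  fix m assume "\<exists>p. path_between G x p y \<and> length p = Suc m"
  then obtain p where "path_between G x p y" "length p = Suc m" by blast
  then show "n \<le> m" using assms(3)[of m] walk_of_path[of G x p y] by simp
qed

text \<open>The distance from \<open>x\<close> is the only potential that vanishes exactly at \<open>x\<close>, grows by at most one
  along an edge, and decreases along some edge everywhere else. This identifies the distances of a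
  graph with a known structure without any handling of paths.\<close>

lemma vdist_eqI:
  assumes "simple_graph G" and "x \<in> verts G" and "y \<in> verts G" and "f x = 0"
    and lip: "\<And>v w. {v, w} \<in> edges G \<Longrightarrow> f w \<le> Suc (f v)"
    and pred: "\<And>w. w \<in> verts G \<Longrightarrow> w \<noteq> x \<Longrightarrow> \<exists>v. {v, w} \<in> edges G \<and> f w = Suc (f v)"
  shows "vdist G x y = f y"
proof (rule vdist_eq_walk[OF assms(1)])
  have "walk G x n w" if "w \<in> verts G" "f w = n" for n w
    using that
  proof (induction n arbitrary: w)
    case 0
    then show ?case using pred[of w] assms(2) by (cases "w = x") (auto intro: walk_refl)
  next
    case (Suc n)
    then have "w \<noteq> x" using assms(4) by auto
    with Suc pred[of w] obtain v where "{v, w} \<in> edges G" "f v = n" by auto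
    then show ?case
      using Suc.IH[of v] simple_graph_edgeD(1)[OF assms(1)] by (auto intro: walk_step)
  qed
  then show "walk G x (f y) y" using assms(3) by simp
next
  fix m assume "walk G x m y"
  then show "f y \<le> m"
    by induction (use assms(4) lip in \<open>auto intro: le_trans\<close>)
qed

locale connected_simple_graph =
  fixes G :: "'a sgraph"
  assumes simple: "simple_graph G" and connected: "connected_graph G"
begin

lemmas edgeD = simple_graph_edgeD[OF simple]

lemma finite_verts: "finite (verts G)"
  using simple by (simp add: simple_graph_def)

lemma edge_obtain:
  assumes "e \<in> edges G"
  obtains x y where "e = {x, y}" "x \<in> verts G" "y \<in> verts G" "x \<noteq> y"
  using assms simple by (auto simp: simple_graph_def)

lemma edge_subset_verts: "e \<in> edges G \<Longrightarrow> e \<subseteq> verts G"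
  by (auto elim: edge_obtain)

lemma finite_edges: "finite (edges G)"
  by (rule finite_subset[of _ "Pow (verts G)"]) (use edge_subset_verts finite_verts in auto)

lemma edge_finite_nonempty:
  assumes "e \<in> edges G"
  shows "finite e" "e \<noteq> {}"
  using assms by (auto elim: edge_obtain)

lemma distinct_edges_not_subset:
  assumes "e \<in> edges G" "f \<in> edges G" "e \<noteq> f"
  shows "\<exists>x\<in>e. x \<notin> f"
  using assms by (auto elim!: edge_obtain)

lemma vdist_walk:
  assumes "x \<in> verts G" "y \<in> verts G"
  shows "walk G x (vdist G x y) y \<and> (\<forall>m. walk G x m y \<longrightarrow> vdist G x y \<le> m)"
proof -
  obtain p where "path_between G x p y"
    using connected assms by (auto simp: connected_graph_def)
  then have "\<exists>n. walk G x n y" using walk_of_path by metis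
  then have "walk G x (LEAST n. walk G x n y) y" by (rule LeastI_ex)
  then show ?thesis
    using vdist_eq_walk[OF simple, of x _ y] Least_le[of "\<lambda>n. walk G x n y"] by metis
qed

lemma vdist_eq_0_iff:
  assumes "x \<in> verts G" "y \<in> verts G"
  shows "vdist G x y = 0 \<longleftrightarrow> x = y"
proof
  assume "vdist G x y = 0"
  then have "walk G x 0 y" using vdist_walk[OF assms] by simp
  then show "x = y" by cases auto
next
  assume "x = y"
  then show "vdist G x y = 0" using vdist_walk[OF assms] walk_refl[OF assms(1)] by auto
qed

lemma vdist_edge:
  assumes "x \<in> verts G" "{y, z} \<in> edges G"
  shows "vdist G x z \<le> Suc (vdist G x y)"
  using assms vdist_walk edgeD by (meson walk_step)

lemma vdist_pred:
  assumes "x \<in> verts G" "y \<in> verts G" "x \<noteq> y"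
  shows "\<exists>z. {z, y} \<in> edges G \<and> vdist G x y = Suc (vdist G x z)"
proof -
  have "walk G x (vdist G x y) y" using vdist_walk assms by blast
  then show ?thesis
  proof cases
    case walk_refl
    then show ?thesis using assms by simp
  next
    case (walk_step n z)
    then have "vdist G x z \<le> n" using vdist_walk assms(1) edgeD(1) by blast
    then have "vdist G x y = Suc (vdist G x z)"
      using walk_step vdist_edge[OF assms(1)] by (metis Suc_le_mono le_antisym)
    then show ?thesis using walk_step by blast
  qed
qed

lemma vdist_triangle:
  assumes "x \<in> verts G" "y \<in> verts G" "z \<in> verts G"
  shows "vdist G x z \<le> vdist G x y + vdist G y z"
proof -
  have "vdist G x w \<le> vdist G x y + n" if "w \<in> verts G" "vdist G y w = n" for n w
    using that
  proof (induction n arbitrary: w)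
    case 0
    then show ?case using vdist_eq_0_iff assms(2) by simp
  next
    case (Suc n)
    then have "y \<noteq> w" using vdist_eq_0_iff by force
    then obtain v where v: "{v, w} \<in> edges G" "vdist G y v = n"
      using vdist_pred Suc.prems assms(2) by fastforce
    then show ?case
      using Suc.IH[of v] edgeD(1)[OF v(1)] vdist_edge[OF assms(1) v(1)] by simp
  qed
  then show ?thesis using assms(3) by simp
qed

lemma image_edges: "{{f x, f y} | x y. {x, y} \<in> edges G} = image f ` edges G"
proof (intro equalityI subsetI)
  fix d assume "d \<in> {{f x, f y} | x y. {x, y} \<in> edges G}"
  then obtain x y where "d = {f x, f y}" "{x, y} \<in> edges G" by blast
  then show "d \<in> image f ` edges G" by (intro image_eqI[of _ _ "{x, y}"]) auto
next
  fix d assume "d \<in> image f ` edges G"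
  then obtain e where e: "d = f ` e" "e \<in> edges G" by blast
  obtain x y where "e = {x, y}" using e(2) by (rule edge_obtain)
  with e show "d \<in> {{f x, f y} | x y. {x, y} \<in> edges G}" by auto
qed

lemma edist_pair: "edist G s {x, y} = min (vdist G s x) (vdist G s y)"
  by (simp add: edist_def)

lemma edist_eq_0_iff:
  assumes "s \<in> verts G" "e \<in> edges G"
  shows "edist G s e = 0 \<longleftrightarrow> s \<in> e"
proof -
  obtain x y where e: "e = {x, y}" "x \<in> verts G" "y \<in> verts G"
    using assms(2) by (rule edge_obtain)
  show ?thesis
    using vdist_eq_0_iff[OF assms(1) e(2)] vdist_eq_0_iff[OF assms(1) e(3)] e(1)
    by (auto simp: edist_pair min_def)
qed

lemma edist_triangle:
  assumes "s \<in> verts G" "u \<in> verts G" "e \<in> edges G"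
  shows "edist G s e \<le> vdist G s u + edist G u e"
proof -
  obtain x y where e: "e = {x, y}" "x \<in> verts G" "y \<in> verts G"
    using assms(3) by (rule edge_obtain)
  show ?thesis
    using vdist_triangle[OF assms(1,2) e(2)] vdist_triangle[OF assms(1,2) e(3)] e(1)
    by (simp add: edist_pair min_def)
qed

end

section \<open>Sets resolving the pairs of edges equidistant from a root\<close>

text \<open>Discriminators are chosen level by level, but only their union is counted. Hence a single set
  used on every level with at least two edges does as well as any choice, and \<open>rooted_edim G u\<close> is
  the least size of such a set (\<open>rooted_edim_le\<close> and \<open>rooted_edim_attained\<close>).\<close>

definition rooted_generator :: "'a sgraph \<Rightarrow> 'a \<Rightarrow> 'a set \<Rightarrow> bool" where
  "rooted_generator G u S \<longleftrightarrow> S \<subseteq> verts G \<and>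
     (\<forall>e\<in>edges G. \<forall>f\<in>edges G. e \<noteq> f \<longrightarrow> edist G u e = edist G u f \<longrightarrow>
        (\<exists>s\<in>S. edist G s e \<noteq> edist G s f))"

lemma two_le_card_iff:
  assumes "finite F"
  shows "2 \<le> card F \<longleftrightarrow> (\<exists>e\<in>F. \<exists>f\<in>F. e \<noteq> f)"
  using card_le_Suc0_iff_eq[OF assms] by (auto simp: not_less_eq_eq[symmetric] numeral_2_eq_2)

context connected_simple_graph
begin

lemma rooted_generator_verts: "rooted_generator G u (verts G)"
  unfolding rooted_generator_def
proof (intro conjI ballI impI)
  fix e f assume ef: "e \<in> edges G" "f \<in> edges G" "e \<noteq> f"
  then obtain x where "x \<in> e" "x \<notin> f" using distinct_edges_not_subset by blast
  then show "\<exists>s\<in>verts G. edist G s e \<noteq> edist G s f"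
    using ef edge_subset_verts edist_eq_0_iff by (metis subsetD)
qed simp

lemma finite_edges_at: "finite (edges_at G u k)"
  using finite_edges by (simp add: edges_at_def)

lemma rooted_generator_Union_discriminators:
  assumes "\<And>k. equidistant_discriminator G (edges_at G u k) (S k)"
  shows "rooted_generator G u (\<Union>k. S k)"
  unfolding rooted_generator_def
proof (intro conjI ballI impI)
  show "(\<Union>k. S k) \<subseteq> verts G"
    using assms by (fastforce simp: equidistant_discriminator_def edge_metric_generator_def
        split: if_splits)
next
  fix e f assume ef: "e \<in> edges G" "f \<in> edges G" "e \<noteq> f" "edist G u e = edist G u f"
  define k where "k = edist G u e"
  have "e \<in> edges_at G u k" "f \<in> edges_at G u k" using ef by (auto simp: k_def edges_at_def)
  moreover from this have "2 \<le> card (edges_at G u k)"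
    using ef(3) two_le_card_iff[OF finite_edges_at] by blast
  ultimately show "\<exists>s\<in>\<Union>k. S k. edist G s e \<noteq> edist G s f"
    using assms[of k] ef(3) by (force simp: equidistant_discriminator_def edge_metric_generator_def)
qed

lemma discriminators_of_rooted_generator:
  assumes "rooted_generator G u S"
  shows "equidistant_discriminator G (edges_at G u k)
           (if 2 \<le> card (edges_at G u k) then S else {})"
  using assms
  by (auto simp: equidistant_discriminator_def edge_metric_generator_def rooted_generator_def
      edges_at_def)

lemma rooted_edim_le:
  assumes "rooted_generator G u S"
  shows "rooted_edim G u \<le> card S"
proof -
  define D where "D k = (if 2 \<le> card (edges_at G u k) then S else {})" for k
  have "finite S"
    using assms finite_verts by (auto simp: rooted_generator_def intro: finite_subset)
  moreover have "(\<Union>k. D k) \<subseteq> S" by (auto simp: D_def split: if_splits)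
  ultimately have "card (\<Union>k. D k) \<le> card S" by (rule card_mono)
  moreover have "rooted_edim G u \<le> card (\<Union>k. D k)"
    unfolding rooted_edim_def
    using discriminators_of_rooted_generator[OF assms]
    by (intro Least_le exI[of _ D]) (simp add: D_def)
  ultimately show ?thesis by simp
qed

lemma rooted_edim_attained: "\<exists>S. rooted_generator G u S \<and> card S = rooted_edim G u"
proof -
  let ?P = "\<lambda>n. \<exists>S. (\<forall>k. equidistant_discriminator G (edges_at G u k) (S k)) \<and> card (\<Union>k. S k) = n"
  have "\<exists>n. ?P n"
    using discriminators_of_rooted_generator[OF rooted_generator_verts, of u] by fast
  then have "?P (rooted_edim G u)"
    unfolding rooted_edim_def by (rule LeastI_ex)
  then show ?thesis using rooted_generator_Union_discriminators by blast
qed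

text \<open>If no two edges are equidistant from \<open>u\<close>, then each vertex at distance \<open>k + 1\<close> is the far end of
  the only edge at distance \<open>k\<close>. So a vertex is determined by its distance from \<open>u\<close>, and listing
  the vertices by distance shows a path.\<close>

lemma equidistant_edges_exist:
  assumes u: "u \<in> verts G" and "\<not> rooted_path G u"
  shows "\<exists>e\<in>edges G. \<exists>f\<in>edges G. e \<noteq> f \<and> edist G u e = edist G u f"
proof (rule ccontr)
  assume "\<not> ?thesis"
  then have uniq: "e = f"
    if "e \<in> edges G" "f \<in> edges G" "edist G u e = edist G u f" for e f
    using that by blast
  have inj: "v = w" if vw: "v \<in> verts G" "w \<in> verts G" "vdist G u v = vdist G u w" for v w
  proof (cases "u = v")
    case True
    then show ?thesis using vw vdist_eq_0_iff u by metis
  next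
    case False
    then have "u \<noteq> w" using vw vdist_eq_0_iff u by metis
    with False obtain v' w' where
      v': "{v', v} \<in> edges G" "vdist G u v = Suc (vdist G u v')" and
      w': "{w', w} \<in> edges G" "vdist G u w = Suc (vdist G u w')"
      using vdist_pred[OF u] vw by metis
    then have "{v', v} = {w', w}"
      using vw(3) by (intro uniq) (auto simp: edist_pair)
    then show ?thesis using v' w' vw(3) by (auto simp: doubleton_eq_iff)
  qed
  define m where "m = Max (vdist G u ` verts G)"
  have le_m: "vdist G u v \<le> m" if "v \<in> verts G" for v
    using that finite_verts by (simp add: m_def)
  have "m \<in> vdist G u ` verts G"
    unfolding m_def using finite_verts u by (intro Max_in) auto
  then obtain far where far: "far \<in> verts G" "vdist G u far = m" by auto
  \<comment> \<open>The levels form an initial segment of the natural numbers: step down towards \<open>u\<close> from a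
    vertex at the largest distance.\<close>
  have level: "\<exists>v\<in>verts G. vdist G u v = i" if "i \<le> m" for i
    using that
  proof (induction rule: inc_induct)
    case base
    then show ?case using far by blast
  next
    case (step n)
    then obtain v where v: "v \<in> verts G" "vdist G u v = Suc n" by blast
    then have "u \<noteq> v" using vdist_eq_0_iff by force
    then show ?case using vdist_pred[OF u v(1)] v(2) edgeD(1) by auto
  qed
  define at where "at i = (SOME v. v \<in> verts G \<and> vdist G u v = i)" for i
  have at: "at i \<in> verts G" "vdist G u (at i) = i" if "i \<le> m" for i
    using someI_ex[of "\<lambda>v. v \<in> verts G \<and> vdist G u v = i"] level[OF that]
    unfolding at_def by blast+
  have at_vdist: "at (vdist G u v) = v" if "v \<in> verts G" for v
    using inj at le_m that by metis
  have consecutive: "{at i, at (Suc i)} \<in> edges G" if i: "Suc i \<le> m" for i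
  proof -
    have "u \<noteq> at (Suc i)" using at[OF i] vdist_eq_0_iff by force
    then obtain v where v: "{v, at (Suc i)} \<in> edges G" "vdist G u v = i"
      using vdist_pred[OF u at(1)[OF i]] at(2)[OF i] by auto
    then have "v = at i" using at_vdist[of v] edgeD(1) by simp
    with v(1) show ?thesis by simp
  qed
  have edge_form: "\<exists>i. e = {at i, at (Suc i)} \<and> Suc i \<le> m" if edge: "e \<in> edges G" for e
  proof -
    have step: "\<exists>i. {x, y} = {at i, at (Suc i)} \<and> Suc i \<le> m"
      if xy: "{x, y} \<in> edges G" "vdist G u x < vdist G u y" for x y
    proof -
      have "vdist G u y = Suc (vdist G u x)" using xy vdist_edge[OF u xy(1)] by simp
      then have "{x, y} = {at (vdist G u x), at (Suc (vdist G u x))}" "Suc (vdist G u x) \<le> m"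
        using at_vdist[of x] at_vdist[of y] le_m[of y] edgeD(1,2)[OF xy(1)] by auto
      then show ?thesis by blast
    qed
    obtain x y where e: "e = {x, y}" "x \<in> verts G" "y \<in> verts G" "x \<noteq> y"
      using edge by (rule edge_obtain)
    then have "vdist G u x \<noteq> vdist G u y" using inj by blast
    then show ?thesis
      using step[of x y] step[of y x] edge e(1) by (auto simp: insert_commute neq_iff)
  qed
  let ?vs = "map at [0..<Suc m]"
  have "path_graph_order G ?vs"
    unfolding path_graph_order_def
  proof (intro conjI)
    show "distinct ?vs"
      using at(2) by (auto simp: distinct_map inj_on_def simp del: upt_Suc) (metis less_Suc_eq_le)
    show "verts G = set ?vs"
    proof
      show "verts G \<subseteq> set ?vs"
      proof
        fix v assume "v \<in> verts G"
        then show "v \<in> set ?vs"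
          using at_vdist[of v] le_m[of v]
          by (auto simp: image_iff simp del: upt_Suc intro!: bexI[of _ "vdist G u v"])
      qed
      show "set ?vs \<subseteq> verts G" using at(1) by (auto simp del: upt_Suc)
    qed
    have nth: "?vs ! i = at i" if "i \<le> m" for i
      using that by (simp del: upt_Suc)
    have "{at i, at (Suc i)} = {?vs ! i, ?vs ! Suc i}" if "Suc i \<le> m" for i
      using that nth by (simp del: upt_Suc)
    then show "edges G = {{?vs ! i, ?vs ! Suc i} | i. Suc i < length ?vs}"
      using consecutive edge_form by (force simp del: upt_Suc simp: less_Suc_eq_le)
  qed simp
  moreover have "hd ?vs = u"
    using at_vdist[OF u] vdist_eq_0_iff[OF u u] by (simp add: hd_map del: upt_Suc)
  ultimately show False using assms(2) by (auto simp: rooted_path_def)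
qed

end

section \<open>Distances in the hierarchical product\<close>

lemma Min_add_image:
  fixes f :: "'a \<Rightarrow> nat"
  assumes "finite e" "e \<noteq> {}"
  shows "Min ((\<lambda>x. c + f x) ` e) = c + Min (f ` e)"
  using assms Min_add_commute[of e f c] by (simp add: add.commute)

locale hierarchical_product =
  G: connected_simple_graph G + H: connected_simple_graph H
  for G :: "'a sgraph" and H :: "'b sgraph" +
  fixes u :: 'a
  assumes root: "u \<in> verts G"
begin

definition X :: "('a \<times> 'b) sgraph" where
  "X = hier_prod G u H"

abbreviation copy_edge :: "'a set \<Rightarrow> 'b \<Rightarrow> ('a \<times> 'b) set" where
  "copy_edge e h \<equiv> (\<lambda>g. (g, h)) ` e"

abbreviation root_edge :: "'b set \<Rightarrow> ('a \<times> 'b) set" where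
  "root_edge e \<equiv> Pair u ` e"

lemma verts_X: "verts X = verts G \<times> verts H"
  by (simp add: X_def hier_prod_def)

lemma edges_X:
  "edges X = {copy_edge e h | e h. e \<in> edges G \<and> h \<in> verts H} \<union> root_edge ` edges H"
proof -
  have "{{(g, h), (g', h)} | g g' h. {g, g'} \<in> edges G \<and> h \<in> verts H}
      = (\<Union>h\<in>verts H. {{(g, h), (g', h)} | g g'. {g, g'} \<in> edges G})"
    by blast
  also have "\<dots> = {copy_edge e h | e h. e \<in> edges G \<and> h \<in> verts H}"
    unfolding G.image_edges[of "\<lambda>g. (g, h)" for h] by blast
  finally show ?thesis
    using H.image_edges[of "Pair u"] by (simp add: X_def hier_prod_def)
qed

lemma edge_X_cases:
  assumes "d \<in> edges X"
  obtains (copy) e h where "d = copy_edge e h" "e \<in> edges G" "h \<in> verts H"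
  | (link) e where "d = root_edge e" "e \<in> edges H"
  using assms by (auto simp: edges_X)

lemma simple_X: "simple_graph X"
  unfolding simple_graph_def
proof (intro conjI ballI)
  show "finite (verts X)" using G.finite_verts H.finite_verts by (simp add: verts_X)
  fix d assume "d \<in> edges X"
  then show "\<exists>x y. x \<in> verts X \<and> y \<in> verts X \<and> x \<noteq> y \<and> d = {x, y}"
  proof (cases rule: edge_X_cases)
    case (copy e h)
    obtain g g' where "e = {g, g'}" "g \<in> verts G" "g' \<in> verts G" "g \<noteq> g'"
      using copy(2) by (rule G.edge_obtain)
    then have "(g, h) \<in> verts X \<and> (g', h) \<in> verts X \<and> (g, h) \<noteq> (g', h) \<and> d = {(g, h), (g', h)}"
      using copy by (simp add: verts_X)
    then show ?thesis by blast
  next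
    case (link e)
    obtain h h' where "e = {h, h'}" "h \<in> verts H" "h' \<in> verts H" "h \<noteq> h'"
      using link(2) by (rule H.edge_obtain)
    then have "(u, h) \<in> verts X \<and> (u, h') \<in> verts X \<and> (u, h) \<noteq> (u, h') \<and> d = {(u, h), (u, h')}"
      using link root by (simp add: verts_X)
    then show ?thesis by blast
  qed
qed

text \<open>A walk between different copies passes through both roots and projects to a walk of \<open>H\<close>
  between them. The proof checks that the resulting formula is a potential as in \<open>vdist_eqI\<close>.\<close>

lemma vdist_X:
  assumes "g \<in> verts G" "h \<in> verts H" "g' \<in> verts G" "h' \<in> verts H"
  shows "vdist X (g, h) (g', h') =
    (if h = h' then vdist G g g' else vdist G g u + vdist H h h' + vdist G u g')"
proof -
  define f where "f = (\<lambda>(g', h').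
    if h = h' then vdist G g g' else vdist G g u + vdist H h h' + vdist G u g')"
  \<comment> \<open>Both branches give the same value at a root, so edges between roots need no case distinction.\<close>
  have f_root: "f (u, k) = vdist G g u + vdist H h k" if "k \<in> verts H" for k
    using that assms(2) root by (auto simp: f_def G.vdist_eq_0_iff H.vdist_eq_0_iff)
  have "vdist X (g, h) (g', h') = f (g', h')"
  proof (rule vdist_eqI[OF simple_X])
    show "(g, h) \<in> verts X" "(g', h') \<in> verts X" using assms by (auto simp: verts_X)
    show "f (g, h) = 0" using assms by (simp add: f_def G.vdist_eq_0_iff)
  next
    fix v w assume "{v, w} \<in> edges X"
    then consider a b k where "v = (a, k)" "w = (b, k)" "{a, b} \<in> edges G"
      | k k' where "v = (u, k)" "w = (u, k')" "{k, k'} \<in> edges H"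
      by (auto simp: X_def hier_prod_def doubleton_eq_iff insert_commute)
    then show "f w \<le> Suc (f v)"
    proof cases
      case 1
      then show ?thesis
        using G.vdist_edge[OF assms(1)] G.vdist_edge[OF root] by (simp add: f_def)
    next
      case 2
      then show ?thesis using H.vdist_edge[OF assms(2) 2(3)] f_root H.edgeD by simp
    qed
  next
    fix w assume "w \<in> verts X" "w \<noteq> (g, h)"
    then obtain b k where w: "w = (b, k)" "b \<in> verts G" "k \<in> verts H" by (auto simp: verts_X)
    have in_copy: "{(a, k), (b, k)} \<in> edges X" if "{a, b} \<in> edges G" for a
      using that w(3) by (auto simp: X_def hier_prod_def)
    show "\<exists>v. {v, w} \<in> edges X \<and> f w = Suc (f v)"
    proof (cases "h = k")
      case True
      then obtain a where "{a, b} \<in> edges G" "vdist G g b = Suc (vdist G g a)"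
        using G.vdist_pred[OF assms(1) w(2)] w \<open>w \<noteq> (g, h)\<close> by auto
      then show ?thesis using in_copy w True by (intro exI[of _ "(a, k)"]) (simp add: f_def)
    next
      case other: False
      show ?thesis
      proof (cases "u = b")
        case True
        obtain k' where k': "{k', k} \<in> edges H" "vdist H h k = Suc (vdist H h k')"
          using H.vdist_pred[OF assms(2) w(3) other] by blast
        then have "{(u, k'), w} \<in> edges X"
          unfolding X_def hier_prod_def w(1) True[symmetric] by auto
        moreover have "f w = Suc (f (u, k'))"
          using True w k' f_root H.edgeD[OF k'(1)] by simp
        ultimately show ?thesis by blast
      next
        case False
        then obtain a where "{a, b} \<in> edges G" "vdist G u b = Suc (vdist G u a)"
          using G.vdist_pred[OF root w(2)] by auto
        then show ?thesis using in_copy w other by (intro exI[of _ "(a, k)"]) (simp add: f_def)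
      qed
    qed
  qed
  then show ?thesis by (simp add: f_def)
qed

lemma edist_copy_edge:
  assumes "g \<in> verts G" "h \<in> verts H" "k \<in> verts H" "e \<in> edges G"
  shows "edist X (g, h) (copy_edge e k) =
    (if h = k then edist G g e else vdist G g u + vdist H h k + edist G u e)"
proof -
  have e: "b \<in> verts G" if "b \<in> e" for b
    using that assms(4) G.edge_subset_verts by blast
  have "vdist X (g, h) ` copy_edge e k =
    (\<lambda>b. if h = k then vdist G g b else (vdist G g u + vdist H h k) + vdist G u b) ` e"
    unfolding image_image
    by (rule image_cong[OF refl]) (use assms e in \<open>simp add: vdist_X\<close>)
  then show ?thesis
    using G.edge_finite_nonempty[OF assms(4)] by (simp add: edist_def Min_add_image)
qed

lemma edist_root_edge:
  assumes "g \<in> verts G" "h \<in> verts H" "e \<in> edges H"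
  shows "edist X (g, h) (root_edge e) = vdist G g u + edist H h e"
proof -
  have "vdist X (g, h) ` root_edge e = (\<lambda>k. vdist G g u + vdist H h k) ` e"
    unfolding image_image
  proof (rule image_cong[OF refl])
    fix k assume "k \<in> e"
    then have "k \<in> verts H" using assms(3) H.edge_subset_verts by blast
    then show "vdist X (g, h) (u, k) = vdist G g u + vdist H h k"
      using assms root by (auto simp: vdist_X H.vdist_eq_0_iff G.vdist_eq_0_iff)
  qed
  then show ?thesis
    using H.edge_finite_nonempty[OF assms(3)] by (simp add: edist_def Min_add_image)
qed

section \<open>Generators of the product and of its factor\<close>

text \<open>From another copy, edges of the copy at \<open>h\<close> that are equidistant from the root cannot be told
  apart, so the part of the generator in this copy has to do it.\<close>

lemma generator_trace:
  assumes "edge_metric_generator X (edges X) T" "h \<in> verts H"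
  shows "rooted_generator G u {g. (g, h) \<in> T}"
  unfolding rooted_generator_def
proof (intro conjI ballI impI)
  have T: "T \<subseteq> verts G \<times> verts H"
    using assms(1) by (simp add: edge_metric_generator_def verts_X)
  then show "{g. (g, h) \<in> T} \<subseteq> verts G" by auto
  fix e f assume ef: "e \<in> edges G" "f \<in> edges G" "e \<noteq> f" "edist G u e = edist G u f"
  have "copy_edge e h \<noteq> copy_edge f h"
    using ef(3) by (simp add: inj_image_eq_iff inj_on_def)
  moreover have "copy_edge e h \<in> edges X" "copy_edge f h \<in> edges X"
    using ef assms(2) by (auto simp: edges_X)
  ultimately obtain g k where gk: "(g, k) \<in> T"
    "edist X (g, k) (copy_edge e h) \<noteq> edist X (g, k) (copy_edge f h)"
    using assms(1) unfolding edge_metric_generator_def by fast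
  moreover from this have "g \<in> verts G" "k \<in> verts H" using T by auto
  ultimately have "k = h" "edist G g e \<noteq> edist G g f"
    using ef assms(2) by (auto simp: edist_copy_edge split: if_splits)
  then show "\<exists>s\<in>{g. (g, h) \<in> T}. edist G s e \<noteq> edist G s f" using gk by blast
qed

lemma generator_card_ge:
  assumes "edge_metric_generator X (edges X) T"
  shows "card (verts H) * rooted_edim G u \<le> card T"
proof -
  define Tr where "Tr h = {g. (g, h) \<in> T}" for h
  have T: "T \<subseteq> verts G \<times> verts H"
    using assms by (simp add: edge_metric_generator_def verts_X)
  then have fin: "finite (Tr h)" for h
    by (intro finite_subset[OF _ G.finite_verts]) (auto simp: Tr_def)
  have "T = (\<lambda>(h, g). (g, h)) ` Sigma (verts H) Tr"
    using T by (force simp: Tr_def)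
  then have "card T = card (Sigma (verts H) Tr)"
    by (simp add: card_image inj_on_def case_prod_beta prod_eq_iff)
  then have "card T = (\<Sum>h\<in>verts H. card (Tr h))"
    using H.finite_verts fin by simp
  also have "\<dots> \<ge> (\<Sum>h\<in>verts H. rooted_edim G u)"
    using generator_trace[OF assms] by (intro sum_mono G.rooted_edim_le) (simp add: Tr_def)
  finally show ?thesis by simp
qed

text \<open>An edge between two roots is told apart from any other edge from the copy at a suitable one of
  its ends, and two edges of one copy from this copy or from any other one. The delicate pair is
  that of an edge \<open>e\<close> in the copy at \<open>h\<close> and an edge \<open>f\<close> in another copy at \<open>k\<close>. Let \<open>s\<close> be in \<open>S\<close> and
  write \<open>D = d(h, k) > 0\<close>. If both \<open>(s, h)\<close> and \<open>(s, k)\<close> failed, then the triangle inequality would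
  give \<open>D + d(u, f) \<le> d(u, e)\<close> and \<open>D + d(u, e) \<le> d(u, f)\<close>.\<close>

lemma generator_product:
  assumes S: "rooted_generator G u S" and "S \<noteq> {}" and card_H: "2 \<le> card (verts H)"
  shows "edge_metric_generator X (edges X) (S \<times> verts H)"
proof -
  let ?resolved = "\<lambda>d d'. \<exists>s\<in>S \<times> verts H. edist X s d \<noteq> edist X s d'"
  have SG: "S \<subseteq> verts G" using S by (simp add: rooted_generator_def)
  obtain s where s: "s \<in> S" "s \<in> verts G" using assms(2) SG by blast
  have copy_copy: "?resolved (copy_edge e h) (copy_edge f k)"
    if e: "e \<in> edges G" "h \<in> verts H" and f: "f \<in> edges G" "k \<in> verts H"
      and neq: "copy_edge e h \<noteq> copy_edge f k" for e h f k
  proof (cases "h = k")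
    case same: True
    then have ef: "e \<noteq> f" using neq by blast
    show ?thesis
    proof (cases "edist G u e = edist G u f")
      case True
      then obtain t where "t \<in> S" "edist G t e \<noteq> edist G t f"
        using S e f ef unfolding rooted_generator_def by blast
      then show ?thesis
        using e f same SG by (intro bexI[of _ "(t, h)"]) (auto simp: edist_copy_edge subsetD)
    next
      case False
      obtain k' where "k' \<in> verts H" "k' \<noteq> h"
        using card_H two_le_card_iff[OF H.finite_verts] by metis
      then show ?thesis
        using e f same False s by (intro bexI[of _ "(s, k')"]) (auto simp: edist_copy_edge)
    qed
  next
    case False
    then have D: "vdist H h k > 0" "vdist H k h > 0"
      using e f H.vdist_eq_0_iff by fastforce+
    have "edist X (s, h) (copy_edge e h) \<noteq> edist X (s, h) (copy_edge f k) \<or>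
          edist X (s, k) (copy_edge e h) \<noteq> edist X (s, k) (copy_edge f k)"
      using e f s False D G.edist_triangle[OF s(2) root e(1)] G.edist_triangle[OF s(2) root f(1)]
      by (simp add: edist_copy_edge)
    then show ?thesis using e f s by blast
  qed
  have copy_root: "?resolved (copy_edge e h) (root_edge f)"
    if e: "e \<in> edges G" "h \<in> verts H" and f: "f \<in> edges H" for e h f
  proof -
    \<comment> \<open>The end at \<open>h\<close> itself would not do: an edge of the copy at \<open>h\<close> can be at distance
      \<open>d(s, u)\<close> from \<open>(s, h)\<close>.\<close>
    obtain k where k: "k \<in> f" "k \<noteq> h" "k \<in> verts H"
      using f by (rule H.edge_obtain) auto
    then have "vdist H k h > 0" "edist H k f = 0"
      using e f H.vdist_eq_0_iff H.edist_eq_0_iff by fastforce+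
    then show ?thesis
      using e f k s by (intro bexI[of _ "(s, k)"]) (auto simp: edist_copy_edge edist_root_edge)
  qed
  have root_root: "?resolved (root_edge e) (root_edge f)"
    if e: "e \<in> edges H" and f: "f \<in> edges H" and neq: "root_edge e \<noteq> root_edge f" for e f
  proof -
    obtain k where k: "k \<in> e" "k \<notin> f" "k \<in> verts H"
      using H.distinct_edges_not_subset[OF e f] neq H.edge_subset_verts[OF e] by blast
    then have "edist H k e = 0" "edist H k f \<noteq> 0"
      using e f H.edist_eq_0_iff by blast+
    then show ?thesis
      using e f k s by (intro bexI[of _ "(s, k)"]) (auto simp: edist_root_edge)
  qed
  have "?resolved d d'" if "d \<in> edges X" "d' \<in> edges X" "d \<noteq> d'" for d d'
    using that(1)
  proof (cases rule: edge_X_cases)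
    case d: (copy e h)
    from that(2) show ?thesis
      by (cases rule: edge_X_cases) (use d copy_copy copy_root that(3) in blast)+
  next
    case d: (link e)
    from that(2) show ?thesis
    proof (cases rule: edge_X_cases)
      case (copy f k)
      then show ?thesis using copy_root d by metis
    next
      case (link f)
      then show ?thesis using root_root d that(3) by blast
    qed
  qed
  then show ?thesis
    using SG by (auto simp: edge_metric_generator_def verts_X)
qed

end

theorem theorem2p3:
  fixes G :: "'a sgraph" and H :: "'b sgraph" and u :: 'a
  assumes "simple_graph G" and "connected_graph G"
    and "simple_graph H" and "connected_graph H"
    and "card (verts H) \<ge> 2"
    and "u \<in> verts G"
    and "\<not> rooted_path G u"
  shows "edim (hier_prod G u H) = card (verts H) * rooted_edim G u"
proof -
  interpret hierarchical_product G H u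
    using assms by unfold_locales
  obtain S where S: "rooted_generator G u S" "card S = rooted_edim G u"
    using G.rooted_edim_attained by blast
  have "S \<noteq> {}"
    using G.equidistant_edges_exist[OF assms(6,7)] S(1) by (auto simp: rooted_generator_def)
  then have "edge_metric_generator X (edges X) (S \<times> verts H)"
    using generator_product S(1) assms(5) by blast
  moreover have "card (S \<times> verts H) = card (verts H) * rooted_edim G u"
    using S(2) by (simp add: card_cartesian_product)
  ultimately have "edim X = card (verts H) * rooted_edim G u"
    unfolding edim_def using generator_card_ge
    by (intro Least_equality) blast+
  then show ?thesis by (simp add: X_def)
qed

end
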